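(* In the setting described in the context, let $0\le\varepsilon\le1-E_{\min}$. The inequalities $$\langle\phi_\varepsilon(\mathcal S)\rangle_{\mathcal S}\le\frac{\langle\omega_\varepsilon(\mathcal S)\rangle_{\mathcal S}}{\langle\omega(\mathcal S)\rangle_{\mathcal S}}\le\frac{\int_{E_{\min}+\varepsilon}^1(1-E)^nD(E)\,dE}{\int_0^1(1-E)^nD(E)\,dE}$$ hold if and only if $\phi_\varepsilon(\mathcal S)$ and $\omega(\mathcal S)$ do not correlate negatively, i.e. if and only if $\langle\phi_\varepsilon(\mathcal S)\,\omega(\mathcal S)\rangle_{\mathcal S}-\langle\phi_\varepsilon(\mathcal S)\rangle_{\mathcal S}\langle\omega(\mathcal S)\rangle_{\mathcal S}\ge0$. Equality (of all three quantities) holds if and only if $\phi_\varepsilon(\mathcal S)$ and $\omega(\mathcal S)$ do not correlate, i.e. if and only if $\langle\phi_\varepsilon(\mathcal S)\,\omega(\mathcal S)\rangle_{\mathcal S}=\langle\phi_\varepsilon(\mathcal S)\rangle_{\mathcal S}\langle\omega(\mathcal S)\rangle_{\mathcal S}$.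
   Context: Setting. $P(x,y)$ is a probability distribution on pairs (input $x$, label $y$). $\mathcal W\subseteq\mathbb R^N$ is a compact set of non-zero Lebesgue measure; each $w\in\mathcal W$ determines a classifier $h_w$ mapping inputs to labels, and $\mathcal H_{\mathcal W}=\{h_w: w\in\mathcal W\}$ has finite VC-dimension. The loss is $L(y,h_w(x))\in\{0,1\}$, equal to $0$ if $h_w(x)=y$ and $1$ otherwise. The map $(w,x,y)\mapsto L(y,h_w(x))$ is jointly measurable. The true error of $w$ is $E(w)=\int L(y,h_w(x))\,dP(x,y)\in[0,1]$; it is integrable on $\mathcal W$, and $E_{\min}=\min_{w\in\mathcal W}E(w)$ (assumed attained). Training sets. $n\ge 1$ is an integer and $\mathcal S=\{(x_1,y_1),\dots,(x_n,y_n)\}$ is drawn i.i.d. from $P(x,y)$, i.e. $\mathcal S\sim P(x,y)^n$. The training error is $E_{\mathcal S}(w)=\frac1n\sum_{i=1}^nL(y_i,h_w(x_i))$. $\langle\cdot\rangle_{\mathcal S}$ denotes expectation over $\mathcal S$. Parameter sets and volumes, for $\varepsilon\ge0$: $\mathcal W_\varepsilon=\{w\in\mathcal W:E(w)\ge E_{\min}+\varepsilon\}$; $\mathcal W(\mathcal S)=\{w\in\mathcal W:E_{\mathcal S}(w)=0\}$; $\mathcal W_\varepsilon(\mathcal S)=\{w\in\mathcal W_\varepsilon:E_{\mathcal S}(w)=0\}$. With $|\cdot|$ Lebesgue measure, $\Omega=|\mathcal W|$, $\Omega_\varepsilon=|\mathcal W_\varepsilon|$, $\omega(\mathcal S)=|\mathcal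 W(\mathcal S)|$, $\omega_\varepsilon(\mathcal S)=|\mathcal W_\varepsilon(\mathcal S)|$. Over-parameterization assumption: $\omega(\mathcal S)>0$ for almost all $\mathcal S$ of size $n$. The fraction of bad classifiers among the global minima is $\phi_\varepsilon(\mathcal S)=\omega_\varepsilon(\mathcal S)/\omega(\mathcal S)$ (defined for almost all $\mathcal S$). Density of classifiers. $D(E)$ is the density on $[0,1]$ (with $D(E)=0$ for $E<E_{\min}$) such that $\Omega_\varepsilon=\int_{E_{\min}+\varepsilon}^1D(E)\,dE$ for each $0\le\varepsilon\le1-E_{\min}$. It is understood in the generalized sense: $D(E)\,dE$ is the image of Lebesgue measure on $\mathcal W$ under $w\mapsto E(w)$, point masses are allowed, and $\int_{E_{\min}+\varepsilon}^1$ and $\int_0^1$ include both endpoints. *)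

theory Defs
  imports "HOL-Probability.Probability" "HOL-Library.Extended_Nat"
begin

definition loss :: "'y \<Rightarrow> 'y \<Rightarrow> real" where
  "loss y y' = (if y' = y then 0 else 1)"

text \<open>
  For an arbitrary label type, a class \<open>H\<close> shatters a set of labelled examples if the errors that
  members of \<open>H\<close> make on it realise every subset. For two labels this gives the usual
  VC-dimension of \<open>H\<close>; see \<open>vc_dim_bool\<close> below.
\<close>

definition shatters :: "('x \<Rightarrow> 'y) set \<Rightarrow> ('x \<times> 'y) set \<Rightarrow> bool" where
  "shatters H A \<longleftrightarrow> (\<forall>B\<subseteq>A. \<exists>f\<in>H. {(x, y) \<in> A. loss y (f x) = 1} = B)"

definition vc_dim :: "('x \<Rightarrow> 'y) set \<Rightarrow> enat" where
  "vc_dim H = (SUP A\<in>{A. finite A \<and> shatters H A}. enat (card A))"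

definition true_error :: "('x \<times> 'y) measure \<Rightarrow> ('w \<Rightarrow> 'x \<Rightarrow> 'y) \<Rightarrow> 'w \<Rightarrow> real" where
  "true_error P h w = (LINT (x, y)|P. loss y (h w x))"

definition min_error :: "('x \<times> 'y) measure \<Rightarrow> ('w \<Rightarrow> 'x \<Rightarrow> 'y) \<Rightarrow> 'w set \<Rightarrow> real" where
  "min_error P h W = (INF w\<in>W. true_error P h w)"

definition samples :: "('x \<times> 'y) measure \<Rightarrow> nat \<Rightarrow> (nat \<Rightarrow> 'x \<times> 'y) measure" where
  "samples P n = PiM {..<n} (\<lambda>_. P)"

definition train_error :: "nat \<Rightarrow> ('w \<Rightarrow> 'x \<Rightarrow> 'y) \<Rightarrow> (nat \<Rightarrow> 'x \<times> 'y) \<Rightarrow> 'w \<Rightarrow> real" where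
  "train_error n h S w = 1 / real n * (\<Sum>i<n. case S i of (x, y) \<Rightarrow> loss y (h w x))"

definition bad_params ::
  "('x \<times> 'y) measure \<Rightarrow> ('w \<Rightarrow> 'x \<Rightarrow> 'y) \<Rightarrow> 'w set \<Rightarrow> real \<Rightarrow> 'w set" where
  "bad_params P h W \<epsilon> = {w \<in> W. true_error P h w \<ge> min_error P h W + \<epsilon>}"

definition global_minima ::
  "nat \<Rightarrow> ('w \<Rightarrow> 'x \<Rightarrow> 'y) \<Rightarrow> 'w set \<Rightarrow> (nat \<Rightarrow> 'x \<times> 'y) \<Rightarrow> 'w set" where
  "global_minima n h W S = {w \<in> W. train_error n h S w = 0}"

definition bad_global_minima ::
  "('x \<times> 'y) measure \<Rightarrow> nat \<Rightarrow> ('w \<Rightarrow> 'x \<Rightarrow> 'y) \<Rightarrow> 'w set \<Rightarrow> real \<Rightarrow> (nat \<Rightarrow> 'x \<times> 'y) \<Rightarrow> 'w set" where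
  "bad_global_minima P n h W \<epsilon> S = {w \<in> bad_params P h W \<epsilon>. train_error n h S w = 0}"

definition minima_volume ::
  "nat \<Rightarrow> ('w::euclidean_space \<Rightarrow> 'x \<Rightarrow> 'y) \<Rightarrow> 'w set \<Rightarrow> (nat \<Rightarrow> 'x \<times> 'y) \<Rightarrow> real" where
  "minima_volume n h W S = measure lebesgue (global_minima n h W S)"

definition bad_minima_volume ::
  "('x \<times> 'y) measure \<Rightarrow> nat \<Rightarrow> ('w::euclidean_space \<Rightarrow> 'x \<Rightarrow> 'y) \<Rightarrow> 'w set \<Rightarrow> real
    \<Rightarrow> (nat \<Rightarrow> 'x \<times> 'y) \<Rightarrow> real" where
  "bad_minima_volume P n h W \<epsilon> S = measure lebesgue (bad_global_minima P n h W \<epsilon> S)"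

definition bad_fraction ::
  "('x \<times> 'y) measure \<Rightarrow> nat \<Rightarrow> ('w::euclidean_space \<Rightarrow> 'x \<Rightarrow> 'y) \<Rightarrow> 'w set \<Rightarrow> real
    \<Rightarrow> (nat \<Rightarrow> 'x \<times> 'y) \<Rightarrow> real" where
  "bad_fraction P n h W \<epsilon> S = bad_minima_volume P n h W \<epsilon> S / minima_volume n h W S"

text \<open>
  The density of classifiers \<open>D(E) dE\<close> may have atoms, so it is the measure on the real line
  obtained as the image of Lebesgue measure on \<open>W\<close> under the true error.
\<close>

definition classifier_density ::
  "('x \<times> 'y) measure \<Rightarrow> ('w::euclidean_space \<Rightarrow> 'x \<Rightarrow> 'y) \<Rightarrow> 'w set \<Rightarrow> real measure" where
  "classifier_density P h W = distr (lebesgue_on W) borel (true_error P h)"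

lemma true_error_le_1:
  assumes "prob_space P"
  shows "true_error P h w \<le> 1"
proof -
  interpret prob_space P by fact
  have "true_error P h w \<le> (LINT z|P. 1)"
    unfolding true_error_def
  proof (cases "integrable P (\<lambda>(x, y). loss y (h w x))")
    case True
    then show "(LINT (x, y)|P. loss y (h w x)) \<le> (LINT z|P. 1)"
      by (intro integral_mono) (auto simp: loss_def)
  qed (simp add: not_integrable_integral_eq)
  then show ?thesis by (simp add: prob_space)
qed

lemma bad_params_volume:
  assumes "prob_space P" and "W \<in> sets lebesgue"
    and "true_error P h \<in> borel_measurable (lebesgue_on W)"
  shows "measure (classifier_density P h W) {min_error P h W + \<epsilon>..1}
           = measure lebesgue (bad_params P h W \<epsilon>)"
proof -
  have "bad_params P h W \<epsilon> = true_error P h -` {min_error P h W + \<epsilon>..1} \<inter> W"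
    unfolding bad_params_def using true_error_le_1[OF assms(1)] by auto
  then show ?thesis
    unfolding classifier_density_def using assms
    by (simp add: measure_distr measure_restrict_space)
qed

lemma vc_dim_bool:
  fixes H :: "('x \<Rightarrow> bool) set"
  shows "vc_dim H = (SUP X\<in>{X. finite X \<and> (\<forall>B\<subseteq>X. \<exists>f\<in>H. {x \<in> X. f x} = B)}. enat (card X))"
proof -
  define bin where "bin X \<longleftrightarrow> (\<forall>B\<subseteq>X. \<exists>f\<in>H. {x \<in> X. f x} = B)" for X
  have err: "{(x, y) \<in> A. loss y (f x) = 1} = {p \<in> A. f (fst p) \<noteq> snd p}"
    for f :: "'x \<Rightarrow> bool" and A
    by (auto simp: loss_def)
  have 1: "bin (fst ` A) \<and> card (fst ` A) = card A" if "shatters H A" for A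
  proof
    have ex: "\<exists>f\<in>H. {p \<in> A. f (fst p) \<noteq> snd p} = B" if "B \<subseteq> A" for B
      using \<open>shatters H A\<close> that unfolding shatters_def err by simp
    show "bin (fst ` A)"
      unfolding bin_def
    proof (intro allI impI)
      fix B assume B: "B \<subseteq> fst ` A"
      obtain f where f: "f \<in> H"
          "{p \<in> A. f (fst p) \<noteq> snd p} = {p \<in> A. (fst p \<in> B) \<noteq> snd p}"
        using ex[of "{p \<in> A. (fst p \<in> B) \<noteq> snd p}"] by auto
      have "f (fst p) \<longleftrightarrow> fst p \<in> B" if "p \<in> A" for p
        using f(2)[THEN eqset_imp_iff, of p] that by (cases "snd p") simp_all
      then have "{x \<in> fst ` A. f x} = B" using B by auto
      with f(1) show "\<exists>f\<in>H. {x \<in> fst ` A. f x} = B" by (intro bexI[of _ f])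
    qed
    obtain f where "{p \<in> A. f (fst p) \<noteq> snd p} = {}"
      using ex[of "{}"] by auto
    then have "f (fst p) = snd p" if "p \<in> A" for p
      using that by simp
    then have "inj_on fst A"
      by (intro inj_onI prod_eqI) metis+
    then show "card (fst ` A) = card A" by (rule card_image)
  qed
  have 2: "shatters H ((\<lambda>x. (x, False)) ` X)" if "bin X" for X
    unfolding shatters_def err
  proof (intro allI impI)
    fix B assume "B \<subseteq> (\<lambda>x. (x, False)) ` X"
    then obtain C where C: "C \<subseteq> X" "B = (\<lambda>x. (x, False)) ` C"
      by (rule subset_imageE)
    then obtain f where f: "f \<in> H" "{x \<in> X. f x} = C"
      using \<open>bin X\<close> unfolding bin_def by auto
    have "{p \<in> (\<lambda>x. (x, False)) ` X. f (fst p) \<noteq> snd p} = B"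
      unfolding C(2) f(2)[symmetric] by auto
    with f(1) show "\<exists>f\<in>H. {p \<in> (\<lambda>x. (x, False)) ` X. f (fst p) \<noteq> snd p} = B"
      by (intro bexI[of _ f])
  qed
  have 3: "card ((\<lambda>x. (x, False)) ` X) = card X" for X :: "'x set"
    by (intro card_image inj_onI) simp
  have "vc_dim H = (SUP X\<in>{X. finite X \<and> bin X}. enat (card X))"
    unfolding vc_dim_def
  proof (rule antisym; rule SUP_mono)
    fix A assume "A \<in> {A. finite A \<and> shatters H A}"
    with 1[of A] show "\<exists>X\<in>{X. finite X \<and> bin X}. enat (card A) \<le> enat (card X)"
      by (intro bexI[of _ "fst ` A"]) simp_all
  next
    fix X assume "X \<in> {X. finite X \<and> bin X}"
    with 2[of X] show "\<exists>A\<in>{A. finite A \<and> shatters H A}. enat (card X) \<le> enat (card A)"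
      by (intro bexI[of _ "(\<lambda>x. (x, False)) ` X"]) (simp_all add: 3)
  qed
  then show ?thesis unfolding bin_def .
qed

end

theory Submission
  imports Defs
begin

text \<open>
  A fixed \<open>w\<close> classifies all \<open>n\<close> independent examples correctly with probability \<open>(1 - E(w))^n\<close>, so
  Fubini's theorem gives \<open>\<langle>|{w \<in> A. E\<^sub>S(w) = 0}|\<rangle> = \<integral>\<^sub>A (1 - E(w))^n dw\<close> for every measurable \<open>A\<close>. Hence
  the second inequality is always an equality. As \<open>\<phi> \<omega> = \<omega>\<^sub>\<epsilon>\<close> almost surely and \<open>\<langle>\<omega>\<rangle> > 0\<close>,
  the first one compares \<open>\<langle>\<phi>\<rangle> \<langle>\<omega>\<rangle>\<close> with \<open>\<langle>\<phi> \<omega>\<rangle>\<close>.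
\<close>

text \<open>Both claims come from integrating the indicator of one set \<open>K\<close> of pairs
  \<open>(w, S)\<close>. Integrating over \<open>w\<close> first gives the volume; integrating over
  \<open>S\<close> first gives the probability of a box, a product of \<open>n\<close> equal
  factors. Keeping \<open>Q\<close> abstract separates this from the loss; \<open>A\<close> will be
  the whole of \<open>W\<close> or its bad part.\<close>

lemma integral_measure_section_PiM:
  fixes M :: "'w measure" and P :: "'z measure"
  assumes "finite_measure M" and "prob_space P"
    and Q[measurable]: "Q \<in> sets (M \<Otimes>\<^sub>M P)" and A[measurable]: "A \<in> sets M"
  shows "(\<lambda>S. measure M {w \<in> A. \<forall>i<n. (w, S i) \<in> Q}) \<in> borel_measurable (PiM {..<n} (\<lambda>_. P))"
    and "(LINT S|PiM {..<n} (\<lambda>_. P). measure M {w \<in> A. \<forall>i<n. (w, S i) \<in> Q})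
           = (LINT w:A|M. measure P {z \<in> space P. (w, z) \<in> Q} ^ n)"
proof -
  interpret M: finite_measure M by fact
  interpret P: prob_space P by fact
  interpret PP: finite_product_prob_space "\<lambda>_. P" "{..<n}" by unfold_locales simp
  define PS where "PS = PiM {..<n} (\<lambda>_. P)"
  interpret PS: prob_space PS unfolding PS_def by (rule PP.prob_space_axioms)
  interpret MS: pair_sigma_finite M PS by unfold_locales
  interpret MSf: finite_measure "M \<Otimes>\<^sub>M PS"
    by (rule finite_measure_pair_measure) unfold_locales
  define K where "K = {x \<in> space (M \<Otimes>\<^sub>M PS). fst x \<in> A \<and> (\<forall>i<n. (fst x, snd x i) \<in> Q)}"
  have AM: "A \<subseteq> space M" using A by (rule sets.sets_into_space)
  have [measurable]: "(\<lambda>x. (fst x, snd x i)) \<in> M \<Otimes>\<^sub>M PS \<rightarrow>\<^sub>M M \<Otimes>\<^sub>M P" if "i < n" for i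
    unfolding PS_def using that
    by (intro measurable_Pair measurable_fst
        measurable_compose[OF measurable_snd measurable_component_singleton]) simp
  have K[measurable]: "K \<in> sets (M \<Otimes>\<^sub>M PS)"
    unfolding K_def by measurable
  \<comment> \<open>Both factors are finite measures, so \<open>K\<close> has finite measure and
    Fubini applies.\<close>
  have int: "integrable (M \<Otimes>\<^sub>M PS) (case_prod (\<lambda>w S. indicator K (w, S) :: real))"
    using K by (simp add: integrable_indicator_iff MSf.emeasure_eq_measure)
  have sec: "(LINT w|M. indicator K (w, S)) = measure M {w \<in> A. \<forall>i<n. (w, S i) \<in> Q}"
    if "S \<in> space PS" for S
  proof -
    have "{w \<in> A. \<forall>i<n. (w, S i) \<in> Q} = {w \<in> space M. (w, S) \<in> K}"
      unfolding K_def using AM that by (auto simp: space_pair_measure)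
    moreover have "(\<lambda>w. indicator K (w, S) :: real) = indicator {w. (w, S) \<in> K}"
      by (auto simp: indicator_def)
    ultimately show ?thesis by (simp add: Int_def conj_commute)
  qed
  show "(\<lambda>S. measure M {w \<in> A. \<forall>i<n. (w, S i) \<in> Q}) \<in> borel_measurable (PiM {..<n} (\<lambda>_. P))"
    unfolding PS_def[symmetric]
  proof (subst measurable_cong[OF sec[symmetric]])
    show "(\<lambda>S. LINT w|M. indicator K (w, S) :: real) \<in> borel_measurable PS" by measurable
  qed
  have "(LINT S|PS. measure M {w \<in> A. \<forall>i<n. (w, S i) \<in> Q})
      = (LINT S|PS. LINT w|M. indicator K (w, S))"
    by (rule Bochner_Integration.integral_cong) (simp_all add: sec)
  also have "\<dots> = (LINT w|M. LINT S|PS. indicator K (w, S))"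
    by (rule MS.Fubini_integral[OF int])
  also have "\<dots> = (LINT w|M. indicator A w *\<^sub>R measure P {z \<in> space P. (w, z) \<in> Q} ^ n)"
  proof (rule Bochner_Integration.integral_cong[OF refl])
    fix w assume w: "w \<in> space M"
    have m: "{z \<in> space P. (w, z) \<in> Q} \<in> sets P" using w by measurable
    have "(\<lambda>S. indicator K (w, S) :: real) = indicator {S. (w, S) \<in> K}"
      by (auto simp: indicator_def)
    then have "(LINT S|PS. indicator K (w, S)) = measure PS ({S. (w, S) \<in> K} \<inter> space PS)"
      by simp
    \<comment> \<open>For fixed \<open>w\<close> in \<open>A\<close> the constraints on the
      coordinates of \<open>S\<close> are separate, so the section is a box; independence then
      yields the power. The empty case becomes the factor \<open>indicator A w\<close>.\<close>
    also have "{S. (w, S) \<in> K} \<inter> space PS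
        = (if w \<in> A then PiE {..<n} (\<lambda>_. {z \<in> space P. (w, z) \<in> Q}) else {})"
      by (rule set_eqI) (use w in \<open>auto simp: K_def space_pair_measure PS_def space_PiM PiE_iff\<close>)
    also have "measure PS \<dots> = indicator A w *\<^sub>R measure P {z \<in> space P. (w, z) \<in> Q} ^ n"
      using PP.finite_measure_PiM_emb m by (simp add: PS_def PP.prob_times)
    finally show "(LINT S|PS. indicator K (w, S)) = \<dots>" .
  qed
  finally show "(LINT S|PiM {..<n} (\<lambda>_. P). measure M {w \<in> A. \<forall>i<n. (w, S i) \<in> Q})
           = (LINT w:A|M. measure P {z \<in> space P. (w, z) \<in> Q} ^ n)"
    by (simp add: PS_def set_lebesgue_integral_def)
qed

text \<open>A sum of nonnegative losses vanishes only termwise. For \<open>n = 0\<close> the sum is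
  empty and both sides are true.\<close>

lemma train_error_eq_0_iff:
  "train_error n h S w = 0 \<longleftrightarrow> (\<forall>i<n. h w (fst (S i)) = snd (S i))"
proof (cases "n = 0")
  case False
  have "(\<Sum>i<n. case S i of (x, y) \<Rightarrow> loss y (h w x)) = 0
      \<longleftrightarrow> (\<forall>i\<in>{..<n}. (case S i of (x, y) \<Rightarrow> loss y (h w x)) = 0)"
    by (rule sum_nonneg_eq_0_iff) (auto simp: loss_def split: prod.split)
  with False show ?thesis
    by (auto simp: train_error_def loss_def split_beta)
qed (simp add: train_error_def)

theorem corollary2:
  fixes P :: "('x \<times> 'y) measure"
    and W :: "(real ^ 'N) set"
    and h :: "real ^ 'N \<Rightarrow> 'x \<Rightarrow> 'y"
    and n :: nat
    and \<epsilon> :: real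
  assumes "prob_space P"
    and "compact W"
    and "emeasure lebesgue W \<noteq> 0"
    and "vc_dim (h ` W) < \<infinity>"
    and "(\<lambda>(w, x, y). loss y (h w x)) \<in> borel_measurable (lebesgue_on W \<Otimes>\<^sub>M P)"
    and "integrable (lebesgue_on W) (true_error P h)"
    and "\<exists>w\<in>W. true_error P h w = min_error P h W"
    and "n \<ge> 1"
    and "AE S in samples P n. minima_volume n h W S > 0"
    and "0 \<le> \<epsilon>" and "\<epsilon> \<le> 1 - min_error P h W"
  defines "mean_\<phi> \<equiv> (LINT S|samples P n. bad_fraction P n h W \<epsilon> S)"
    and "mean_\<omega> \<equiv> (LINT S|samples P n. minima_volume n h W S)"
    and "mean_\<omega>\<epsilon> \<equiv> (LINT S|samples P n. bad_minima_volume P n h W \<epsilon> S)"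
    and "mean_\<phi>\<omega> \<equiv> (LINT S|samples P n. bad_fraction P n h W \<epsilon> S * minima_volume n h W S)"
    and "bound \<equiv> (LINT E:{min_error P h W + \<epsilon>..1}|classifier_density P h W. (1 - E) ^ n)
                  / (LINT E:{0..1}|classifier_density P h W. (1 - E) ^ n)"
  shows "(mean_\<phi> \<le> mean_\<omega>\<epsilon> / mean_\<omega> \<and> mean_\<omega>\<epsilon> / mean_\<omega> \<le> bound
            \<longleftrightarrow> mean_\<phi>\<omega> - mean_\<phi> * mean_\<omega> \<ge> 0)
       \<and> (mean_\<phi> = mean_\<omega>\<epsilon> / mean_\<omega> \<and> mean_\<omega>\<epsilon> / mean_\<omega> = bound
            \<longleftrightarrow> mean_\<phi>\<omega> = mean_\<phi> * mean_\<omega>)"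
proof -
  interpret P: prob_space P by fact
  define M where "M = lebesgue_on W"
  have Wl: "W \<in> lmeasurable" using assms(2) by (rule lmeasurable_compact)
  then have Ws: "W \<in> sets lebesgue" by blast
  have spM: "space M = W" by (simp add: M_def space_restrict_space)
  interpret M: finite_measure M unfolding M_def by (rule finite_measure_lebesgue_on[OF Wl])
  interpret PS: prob_space "samples P n"
    unfolding samples_def by (intro prob_space_PiM assms(1))
  let ?E = "true_error P h"
  have L[measurable]: "(\<lambda>(w, x, y). loss y (h w x)) \<in> borel_measurable (M \<Otimes>\<^sub>M P)"
    using assms(5) by (simp add: M_def)
  have E[measurable]: "?E \<in> borel_measurable M"
    using assms(6) by (auto simp: M_def)
  \<comment> \<open>The pairs of a parameter and an example that it classifies correctly; joint
    measurability of the loss makes this set measurable.\<close>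
  define Q where "Q = {p \<in> space (M \<Otimes>\<^sub>M P). (case p of (w, x, y) \<Rightarrow> loss y (h w x)) = 0}"
  have Q: "Q \<in> sets (M \<Otimes>\<^sub>M P)" unfolding Q_def by measurable
  have correct: "measure P {z \<in> space P. (w, z) \<in> Q} = 1 - ?E w" if "w \<in> W" for w
  proof -
    have w: "w \<in> space M" using that spM by simp
    have sQ: "{z \<in> space P. (w, z) \<in> Q} \<in> sets P" using w Q by measurable
    \<comment> \<open>The loss is one minus the indicator of correct classification.\<close>
    have "?E w = (LINT z|P. 1 - indicator {z \<in> space P. (w, z) \<in> Q} z)"
      unfolding true_error_def
      by (rule Bochner_Integration.integral_cong)
        (use w in \<open>auto simp: Q_def space_pair_measure loss_def indicator_def\<close>)
    also have "\<dots> = 1 - measure P {z \<in> space P. (w, z) \<in> Q}"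
      using sQ by (subst Bochner_Integration.integral_diff)
        (auto simp: P.prob_space integrable_indicator_iff P.emeasure_eq_measure Int_def conj_commute)
    finally show ?thesis by simp
  qed
  have E01: "0 \<le> ?E w" "?E w \<le> 1" if "w \<in> W" for w
    using correct[OF that] P.prob_le_1[of "{z \<in> space P. (w, z) \<in> Q}"]
      measure_nonneg[of P "{z \<in> space P. (w, z) \<in> Q}"] by linarith+
  \<comment> \<open>\<open>Q\<close> only contains points of the product space, so \<open>S\<close>
    is taken from the sample space, where each \<open>S i\<close> with \<open>i < n\<close> lies in
    \<open>space P\<close>. Subsets of \<open>W\<close> have the same volume in
    \<open>lebesgue\<close> and in \<open>M\<close>.\<close>
  have vol: "measure lebesgue {w \<in> A. train_error n h S w = 0} = measure M {w \<in> A. \<forall>i<n. (w, S i) \<in> Q}"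
    if "A \<in> sets M" "S \<in> space (samples P n)" for A S
  proof -
    have AW: "A \<subseteq> W" using sets.sets_into_space[OF that(1)] spM by simp
    have "S i \<in> space P" if "i < n" for i
      using \<open>S \<in> space (samples P n)\<close> that by (auto simp: samples_def space_PiM)
    then have eq: "{w \<in> A. train_error n h S w = 0} = {w \<in> A. \<forall>i<n. (w, S i) \<in> Q}"
      using AW spM
      by (auto simp: train_error_eq_0_iff Q_def space_pair_measure loss_def split_beta
          split: if_splits)
    show ?thesis unfolding eq M_def
      by (rule measure_restrict_space[symmetric]) (use AW Ws in auto)
  qed
  have volume_measurable: "(\<lambda>S. measure lebesgue {w \<in> A. train_error n h S w = 0}) \<in> borel_measurable (samples P n)"
    and mean_volume: "(LINT S|samples P n. measure lebesgue {w \<in> A. train_error n h S w = 0})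
          = (LINT w:A|M. (1 - ?E w) ^ n)"
    if A: "A \<in> sets M" for A
  proof -
    note sec = integral_measure_section_PiM[OF M.finite_measure_axioms assms(1) Q A, of n]
    show "(\<lambda>S. measure lebesgue {w \<in> A. train_error n h S w = 0}) \<in> borel_measurable (samples P n)"
      by (subst measurable_cong[OF vol[OF A]]) (use sec(1) in \<open>simp_all add: samples_def\<close>)
    have "(LINT S|samples P n. measure lebesgue {w \<in> A. train_error n h S w = 0})
        = (LINT S|samples P n. measure M {w \<in> A. \<forall>i<n. (w, S i) \<in> Q})"
      by (rule Bochner_Integration.integral_cong[OF refl]) (rule vol[OF A])
    also have "\<dots> = (LINT w:A|M. measure P {z \<in> space P. (w, z) \<in> Q} ^ n)"
      using sec(2) by (simp add: samples_def)
    also have "\<dots> = (LINT w:A|M. (1 - ?E w) ^ n)"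
      unfolding set_lebesgue_integral_def
      by (rule Bochner_Integration.integral_cong) (simp_all add: correct spM)
    finally show "(LINT S|samples P n. measure lebesgue {w \<in> A. train_error n h S w = 0})
          = (LINT w:A|M. (1 - ?E w) ^ n)" .
  qed
  \<comment> \<open>Change of variables along the true error. The upper endpoint cuts nothing off,
    since the error is at most 1.\<close>
  have density: "(LINT E:{a..1}|classifier_density P h W. (1 - E) ^ n)
      = (LINT w:{w \<in> W. a \<le> ?E w}|M. (1 - ?E w) ^ n)" for a
  proof -
    have "(LINT E:{a..1}|classifier_density P h W. (1 - E) ^ n)
        = (LINT w|M. indicator {a..1} (?E w) *\<^sub>R (1 - ?E w) ^ n)"
      unfolding set_lebesgue_integral_def classifier_density_def M_def[symmetric]
      by (rule integral_distr) measurable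
    also have "\<dots> = (LINT w:{w \<in> W. a \<le> ?E w}|M. (1 - ?E w) ^ n)"
      unfolding set_lebesgue_integral_def
      by (rule Bochner_Integration.integral_cong) (auto simp: indicator_def spM E01)
    finally show ?thesis .
  qed
  have badM: "bad_params P h W \<epsilon> \<in> sets M"
  proof -
    have "{w \<in> space M. min_error P h W + \<epsilon> \<le> ?E w} \<in> sets M" by measurable
    then show ?thesis by (simp add: bad_params_def spM)
  qed
  have WM: "W \<in> sets M" using sets.top[of M] by (simp add: spM)
  have \<omega>: "mean_\<omega> = (LINT w:W|M. (1 - ?E w) ^ n)"
    unfolding mean_\<omega>_def minima_volume_def global_minima_def by (rule mean_volume[OF WM])
  have \<omega>\<epsilon>: "mean_\<omega>\<epsilon> = (LINT w:bad_params P h W \<epsilon>|M. (1 - ?E w) ^ n)"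
    unfolding mean_\<omega>\<epsilon>_def bad_minima_volume_def bad_global_minima_def by (rule mean_volume[OF badM])
  \<comment> \<open>Errors are nonnegative, so \<open>density\<close> at \<open>a = 0\<close> gives
    the denominator \<open>mean_\<omega>\<close>; at the bad threshold it gives
    \<open>mean_\<omega>\<epsilon>\<close>.\<close>
  have "{w \<in> W. 0 \<le> ?E w} = W" using E01 by auto
  then have bound: "bound = mean_\<omega>\<epsilon> / mean_\<omega>"
    unfolding bound_def density \<omega> \<omega>\<epsilon> bad_params_def by simp
  have \<omega>_meas: "minima_volume n h W \<in> borel_measurable (samples P n)"
    using volume_measurable[OF WM] unfolding minima_volume_def global_minima_def .
  \<comment> \<open>The total volume of \<open>W\<close> bounds \<open>\<omega>\<close>, which makes
    it integrable over a probability space.\<close>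
  have \<omega>_le: "minima_volume n h W S \<le> measure M (space M)" if "S \<in> space (samples P n)" for S
    unfolding minima_volume_def global_minima_def vol[OF WM that] by (rule M.bounded_measure)
  have "integrable (samples P n) (minima_volume n h W)"
    by (rule PS.integrable_const_bound[OF _ \<omega>_meas, where B = "measure M (space M)"])
      (use \<omega>_le in \<open>auto simp: minima_volume_def\<close>)
  \<comment> \<open>Over-parameterization enters here: an almost surely positive integrable function
    has positive mean.\<close>
  then have pos: "mean_\<omega> > 0"
    unfolding mean_\<omega>_def using PS.integral_less_AE_space[of "\<lambda>_. 0" "minima_volume n h W"] assms(9)
    by (simp add: PS.emeasure_space_1)
  have "mean_\<phi>\<omega> = mean_\<omega>\<epsilon>"
    unfolding mean_\<phi>\<omega>_def mean_\<omega>\<epsilon>_def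
  proof (rule integral_cong_AE)
    have "bad_minima_volume P n h W \<epsilon> \<in> borel_measurable (samples P n)"
      using volume_measurable[OF badM] unfolding bad_minima_volume_def bad_global_minima_def .
    with \<omega>_meas show "(\<lambda>S. bad_fraction P n h W \<epsilon> S * minima_volume n h W S) \<in> borel_measurable (samples P n)"
      and "bad_minima_volume P n h W \<epsilon> \<in> borel_measurable (samples P n)"
      unfolding bad_fraction_def by measurable
    \<comment> \<open>The quotient cancels wherever \<open>\<omega>\<close> is nonzero, hence almost
      surely.\<close>
    show "AE S in samples P n. bad_fraction P n h W \<epsilon> S * minima_volume n h W S
        = bad_minima_volume P n h W \<epsilon> S"
      using assms(9) by eventually_elim (simp add: bad_fraction_def)
  qed
  \<comment> \<open>Multiplying by \<open>mean_\<omega> > 0\<close> turns the comparison of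
    \<open>mean_\<phi>\<close> with the ratio into one of \<open>mean_\<phi> * mean_\<omega>\<close>
    with \<open>mean_\<phi>\<omega>\<close>.\<close>
  with bound pos show ?thesis
    by (auto simp: field_simps)
qed

end
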